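(* Let $\lambda$ be a real number with $\lambda\ne 0,1$. For every integer $n\ge 0$, \[ K_{n,\lambda}(x)=\sum_{m=0}^n\left(\frac{\lambda^{-m}}{m!}\sum_{l=0}^m\binom{m}{l}(-1)^{m-l}\Big(K_{n,\lambda}(l\lambda)-n\,K_{n-1,\lambda}(l\lambda)\Big)\right)b_{m,\lambda}(x), \] where for $n=0$ the term $n\,K_{n-1,\lambda}(l\lambda)$ is interpreted as $0$.
   Context: For a nonzero real $\lambda$, the degenerate ordered Bell polynomials $b_{n,\lambda}(x)$ are defined by the formal power series identity \[ \frac{1}{2-(1+\lambda t)^{1/\lambda}}(1+\lambda t)^{x/\lambda}=\sum_{n=0}^\infty b_{n,\lambda}(x)\frac{t^n}{n!}, \] where $(1+\lambda t)^{a/\lambda}=\exp\big(\tfrac{a}{\lambda}\log(1+\lambda t)\big)$. For $\lambda\ne0,1$ the Korobov polynomials $K_{n,\lambda}(x)$ are defined by \[ \frac{\lambda t}{(1+t)^\lambda-1}(1+t)^x=\sum_{n=0}^\infty K_{n,\lambda}(x)\frac{t^n}{n!}, \] with $(1+t)^a=\exp(a\log(1+t))$. *)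

theory Defs
  imports Complex_Main "HOL-Computational_Algebra.Formal_Power_Series"
begin

text \<open>
  \<open>fps_pow1 c a\<close> is the formal power series $(1 + c t)^a = \exp (a \log (1 + c t))$.
  In the library, \<open>fps_exp c\<close> is $e^{ct}$ and \<open>fps_ln 1\<close> is $\log (1 + t)$.
\<close>

definition fps_pow1 :: "real \<Rightarrow> real \<Rightarrow> real fps" where
  "fps_pow1 c a = fps_exp 1 oo (fps_const a * (fps_ln 1 oo (fps_const c * fps_X)))"

text \<open>
  The polynomials are represented by their values at real \<open>x\<close>; the coefficient of
  $t^n / n!$ is $n!$ times that of $t^n$. The parameter \<open>l\<close> is meant to be nonzero
  (and different from 1 for the Korobov polynomials).
\<close>

definition degenerate_bell_gf :: "real \<Rightarrow> real \<Rightarrow> real fps" where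
  "degenerate_bell_gf l x = 1 / (2 - fps_pow1 l (1 / l)) * fps_pow1 l (x / l)"

definition degenerate_bell :: "nat \<Rightarrow> real \<Rightarrow> real \<Rightarrow> real" where
  "degenerate_bell n l x = fact n * fps_nth (degenerate_bell_gf l x) n"

text \<open>
  Numerator and denominator of the quotient below both have subdegree 1 when $\lambda \neq 0$,
  so division of formal power series cancels the common factor $t$ and is exact.
\<close>

definition korobov_gf :: "real \<Rightarrow> real \<Rightarrow> real fps" where
  "korobov_gf l x = (fps_const l * fps_X) / (fps_pow1 1 l - 1) * fps_pow1 1 x"

definition korobov :: "nat \<Rightarrow> real \<Rightarrow> real \<Rightarrow> real" where
  "korobov n l x = fact n * fps_nth (korobov_gf l x) n"

end

theory Submission
  imports Defs
begin

unbundle fps_syntax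

text \<open>
  Substituting $t \mapsto u = ((1 + t)^\lambda - 1) / \lambda$ turns $(1 + \lambda t)^{a / \lambda}$
  into $(1 + t)^a$, hence the generating function of the degenerate ordered Bell polynomials into
  $(1 + t)^x / (1 - t)$. Multiplying by $(1 - t) G$, where $G = \lambda t / ((1 + t)^\lambda - 1)$,
  gives $G (1 + t)^x = \sum_m b_{m,\lambda}(x) / m! \cdot (1 - t) G u^m$, and expanding $u^m$ by the
  binomial theorem yields the coefficients: $(1 - t) G (1 + t)^{l\lambda}$ has $n$-th coefficient
  $(K_{n,\lambda}(l\lambda) - n K_{n-1,\lambda}(l\lambda)) / n!$.
\<close>

text \<open>Since \<open>u\<close> has no constant term, \<open>u ^ m\<close> starts at degree
  \<open>m\<close> or later. Hence every coefficient of \<open>b oo u\<close> up to degree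
  \<open>n\<close> can be summed over the same range \<open>0..n\<close>, and the two sums may be
  interchanged.\<close>

lemma fps_nth_mult_compose:
  fixes h b u :: "'a::comm_ring_1 fps"
  assumes "u $ 0 = 0"
  shows "(h * (b oo u)) $ n = (\<Sum>m=0..n. b $ m * (h * u ^ m) $ n)"
proof -
  have compose_nth: "(b oo u) $ k = (\<Sum>m=0..n. b $ m * (u ^ m) $ k)" if "k \<le> n" for k
    unfolding fps_compose_nth using that startsby_zero_power_prefix[OF assms]
    by (intro sum.mono_neutral_left) auto
  have "(h * (b oo u)) $ n = (\<Sum>i=0..n. h $ i * (\<Sum>m=0..n. b $ m * (u ^ m) $ (n - i)))"
    by (simp add: fps_mult_nth compose_nth)
  also have "\<dots> = (\<Sum>m=0..n. b $ m * (\<Sum>i=0..n. h $ i * (u ^ m) $ (n - i)))"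
    unfolding sum_distrib_left by (subst sum.swap) (simp add: mult_ac)
  finally show ?thesis
    by (simp add: fps_mult_nth)
qed

text \<open>Associativity of composition moves the factor \<open>a\<close> into the parameter of
  \<open>fps_exp\<close>, where the rule for powers of exponentials applies.\<close>

lemma fps_exp_compose_const_mult:
  fixes f :: "'a::field_char_0 fps"
  assumes "f $ 0 = 0"
  shows "fps_exp 1 oo (fps_const a * f) = fps_exp a oo f"
proof -
  have "fps_const a * f = (fps_const a * fps_X) oo f"
    by (simp add: fps_compose_mult_distrib assms)
  then show ?thesis
    by (simp add: fps_compose_assoc assms)
qed

lemma fps_pow1_1: "fps_pow1 1 a = fps_exp a oo fps_ln 1"
  by (simp add: fps_pow1_def fps_exp_compose_const_mult)

lemma fps_pow1_1_power: "fps_pow1 1 a ^ k = fps_pow1 1 (real k * a)"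
  by (simp add: fps_pow1_1 fps_compose_power fps_exp_power_mult)

lemma fps_pow1_1_1: "fps_pow1 1 1 = 1 + fps_X"
proof -
  \<comment> \<open>The logarithm is the compositional inverse of \<open>fps_exp 1 - 1\<close>; it
    is used as a right inverse here and as a left inverse in the next lemma.\<close>
  have "(fps_exp 1 - 1) oo fps_ln 1 = (fps_X :: real fps)"
    by (simp add: fps_ln_fps_exp_inv fps_inv_fps_exp_compose)
  then show ?thesis
    by (simp add: fps_pow1_1 fps_compose_sub_distrib algebra_simps)
qed

lemma fps_ln_compose_pow1: "fps_ln 1 oo (fps_pow1 1 l - 1) = fps_const l * fps_ln 1"
proof -
  have exp_const: "fps_pow1 1 l - 1 = (fps_exp 1 - 1) oo (fps_const l * fps_ln 1)"
    by (simp add: fps_pow1_def fps_compose_sub_distrib)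
  have "fps_ln 1 oo (fps_exp 1 - 1) = (fps_X :: real fps)"
    by (simp add: fps_ln_fps_exp_inv fps_inv_fps_exp_compose)
  then show ?thesis
    by (simp add: exp_const fps_compose_assoc)
qed

text \<open>The substituted series u satisfies 1 + l u = (1 + t)^l, so log (1 + l u) = l log (1 +
  t). Multiplying by \<open>a\<close> and exponentiating gives the claim.\<close>

lemma fps_pow1_compose:
  assumes "l \<noteq> 0"
  shows "fps_pow1 l a oo (fps_const (1 / l) * (fps_pow1 1 l - 1)) = fps_pow1 1 (a * l)"
proof -
  define u where "u = fps_const (1 / l) * (fps_pow1 1 l - 1)"
  have u0: "u $ 0 = 0"
    by (simp add: u_def fps_pow1_def)
  have "(fps_const l * fps_X) oo u = fps_pow1 1 l - 1"
    using assms by (simp add: fps_compose_mult_distrib u0)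
      (simp add: u_def mult.assoc[symmetric])
  then have "(fps_ln 1 oo (fps_const l * fps_X)) oo u = fps_const l * fps_ln 1"
    by (simp add: fps_compose_assoc[symmetric] u0 fps_ln_compose_pow1)
  then have "(fps_const a * (fps_ln 1 oo (fps_const l * fps_X))) oo u =
      fps_const (a * l) * fps_ln 1"
    by (simp add: fps_compose_mult_distrib u0 mult.assoc[symmetric])
  then have "fps_pow1 l a oo u = fps_exp 1 oo (fps_const (a * l) * fps_ln 1)"
    unfolding fps_pow1_def by (subst fps_compose_assoc[symmetric]) (simp_all add: u0)
  then show ?thesis
    by (simp add: fps_pow1_1 fps_exp_compose_const_mult u_def)
qed

lemma degenerate_bell_gf_compose:
  assumes "l \<noteq> 0"
  shows "(1 - fps_X) * (degenerate_bell_gf l x oo (fps_const (1 / l) * (fps_pow1 1 l - 1))) =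
    fps_pow1 1 x"
proof -
  define u where "u = fps_const (1 / l) * (fps_pow1 1 l - 1)"
  have u0: "u $ 0 = 0"
    by (simp add: u_def fps_pow1_def)
  have pow: "fps_pow1 l a oo u = fps_pow1 1 (a * l)" for a
    using fps_pow1_compose[OF assms] by (simp add: u_def)
  define d where "d = 2 - fps_pow1 l (1 / l)"
  \<comment> \<open>The constant term 2 - 1 = 1 makes \<open>d\<close> a unit: the quotient becomes
    a product with \<open>inverse d\<close>, and inversion commutes with composition.\<close>
  have d0: "d $ 0 = 1"
    by (simp add: d_def fps_pow1_def fps_numeral_nth)
  \<comment> \<open>The exponent \<open>1 / l\<close> turns into 1, so \<open>d\<close> becomes 2 -
    (1 + t).\<close>
  have "d oo u = 1 - fps_X"
    using assms by (simp add: d_def fps_compose_sub_distrib pow fps_pow1_1_1)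
  moreover have "degenerate_bell_gf l x = inverse d * fps_pow1 l (x / l)"
    by (simp add: degenerate_bell_gf_def d_def[symmetric] fps_divide_unit d0)
  ultimately have "degenerate_bell_gf l x oo u = inverse (1 - fps_X) * fps_pow1 1 x"
    using assms by (simp add: fps_compose_mult_distrib fps_inverse_compose u0 d0 pow)
  then show ?thesis
    by (simp add: u_def mult.assoc[symmetric] inverse_mult_eq_1')
qed

text \<open>Multiplying by 1 - t subtracts the preceding coefficient, and n! = n (n - 1)! produces
  the factor \<open>n\<close>. At \<open>n = 0\<close> there is no preceding coefficient.\<close>

lemma korobov_minus_pred:
  "fact n * ((1 - fps_X) * korobov_gf l y) $ n =
    korobov n l y - (if n = 0 then 0 else real n * korobov (n - 1) l y)"
  by (cases n) (simp_all add: korobov_def algebra_simps)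

theorem theorem11:
  fixes lam x :: real and n :: nat
  assumes "lam \<noteq> 0" and "lam \<noteq> 1"
  shows "korobov n lam x =
    (\<Sum>m=0..n. (lam powi (- int m) / fact m *
        (\<Sum>l=0..m. real (m choose l) * (-1) ^ (m - l) *
          (korobov n lam (real l * lam) -
            (if n = 0 then 0 else real n * korobov (n - 1) lam (real l * lam))))) *
      degenerate_bell m lam x)"
proof -
  define G where "G = (fps_const lam * fps_X) / (fps_pow1 1 lam - 1)"
  define u where "u = fps_const (1 / lam) * (fps_pow1 1 lam - 1)"
  define D where "D y = korobov n lam y - (if n = 0 then 0 else real n * korobov (n - 1) lam y)" for y
  have u0: "u $ 0 = 0"
    by (simp add: u_def fps_pow1_def)
  have gf: "korobov_gf lam y = G * fps_pow1 1 y" for y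
    by (simp add: korobov_gf_def G_def)
  have D: "D y = fact n * ((1 - fps_X) * G * fps_pow1 1 y) $ n" for y
    unfolding D_def korobov_minus_pred[symmetric] gf by (simp only: mult.assoc)
  \<comment> \<open>Binomial expansion of ((1 + t)^lam - 1)^m. The l-th power of (1 + t)^lam is (1 +
    t)^(l lam), which is where the arguments \<open>real l * lam\<close> come from. Signs are
    written as constant series so that they pass through coefficient extraction.\<close>
  have u_power: "u ^ m = fps_const (lam powi (- int m)) *
      (\<Sum>l=0..m. fps_const (real (m choose l) * (-1) ^ (m - l)) * fps_pow1 1 (real l * lam))" for m
  proof -
    have "(fps_pow1 1 lam - 1) ^ m =
        (\<Sum>l\<le>m. of_nat (m choose l) * fps_pow1 1 lam ^ l * (- 1) ^ (m - l))"
      using binomial_ring[of "fps_pow1 1 lam" "- 1" m] by simp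
    also have "\<dots> = (\<Sum>l=0..m. fps_const (real (m choose l) * (-1) ^ (m - l)) *
        fps_pow1 1 (real l * lam))"
    proof (intro sum.cong)
      fix l
      have "(- 1 :: real fps) ^ (m - l) = fps_const ((-1) ^ (m - l))"
        by (simp flip: fps_const_power fps_const_neg)
      then show "of_nat (m choose l) * fps_pow1 1 lam ^ l * (- 1) ^ (m - l) =
          fps_const (real (m choose l) * (-1) ^ (m - l)) * fps_pow1 1 (real l * lam)"
        by (simp add: fps_pow1_1_power fps_of_nat[symmetric] mult_ac flip: fps_const_mult)
    qed auto
    finally show ?thesis
      by (simp add: u_def power_mult_distrib power_int_minus power_one_over inverse_eq_divide)
  qed
  have coeff: "fact n * ((1 - fps_X) * G * u ^ m) $ n = lam powi (- int m) *
      (\<Sum>l=0..m. real (m choose l) * (-1) ^ (m - l) * D (real l * lam))" for m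
  proof -
    have "(1 - fps_X) * G * u ^ m = fps_const (lam powi (- int m)) *
        (\<Sum>l=0..m. fps_const (real (m choose l) * (-1) ^ (m - l)) *
          ((1 - fps_X) * G * fps_pow1 1 (real l * lam)))"
      unfolding u_power sum_distrib_left by (intro sum.cong refl) (simp only: mult_ac)
    then show ?thesis
      by (simp only: D fps_mult_left_const_nth fps_sum_nth sum_distrib_left)
        (simp only: mult_ac)
  qed
  \<comment> \<open>The factor 1 - t clears the Bell denominator after the substitution, leaving
    \<open>G\<close> times (1 + t)^x.\<close>
  have "korobov_gf lam x = (1 - fps_X) * G * (degenerate_bell_gf lam x oo u)"
    using degenerate_bell_gf_compose[OF assms(1), of x] by (simp add: gf u_def mult_ac)
  then have "korobov n lam x =
      fact n * (\<Sum>m=0..n. degenerate_bell_gf lam x $ m * ((1 - fps_X) * G * u ^ m) $ n)"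
    by (simp only: korobov_def fps_nth_mult_compose[OF u0])
  also have "\<dots> = (\<Sum>m=0..n. (fact n * ((1 - fps_X) * G * u ^ m) $ n) * degenerate_bell_gf lam x $ m)"
    by (simp only: sum_distrib_left mult_ac)
  \<comment> \<open>The division by \<open>fact m\<close> compensates for the factor
    \<open>fact m\<close> in \<open>degenerate_bell\<close>.\<close>
  also have "\<dots> = (\<Sum>m=0..n. (lam powi (- int m) / fact m *
      (\<Sum>l=0..m. real (m choose l) * (-1) ^ (m - l) * D (real l * lam))) * degenerate_bell m lam x)"
    unfolding coeff degenerate_bell_def by (intro sum.cong) simp_all
  finally show ?thesis
    unfolding D_def .
qed

end
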